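(* Let $x^*\in\mathcal{X}^n$, $v\in\mathbb{C}^m$, $r=Hx^*+v$, and let $t^*\in\mathbb{R}^{nM}$ be the vector corresponding to $x^*$. Let $\overline Q=H^\dagger H-\frac12\mathrm{Diag}(\mathrm{diag}(H^\dagger H))$. Suppose that $$\lambda_{\min}(H^\dagger H)\sin\left(\frac{\pi}{M}\right)>\|H^\dagger v\|_\infty\quad\text{and}\quad \sqrt2\,\lambda_{\min}(\overline Q)\sin\left(\frac{\pi}{M}\right)>\|H^\dagger v\|_\infty.$$ Then any sequence $\{t^k\}$ generated by the PN-QP method (quadratic penalty method) converges to $t^*$, which is the unique global minimizer of the problem (RSQP) $$\min_{t\in\mathbb{R}^{nM}} f(t)\quad\text{s.t. } \boldsymbol{e}^\top\bar t_j=1,\ j=1,\ldots,n,\quad t\geqslant 0,$$ where $f(t)=t^\top\widetilde Gt+2w^\top t$.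
   Context: $m,n\geqslant1$ and $M\geqslant 2$ are integers, $H\in\mathbb{C}^{m\times n}$; $(\cdot)^\dagger$ is the conjugate transpose; $\lambda_{\min}$ is the smallest eigenvalue of a Hermitian matrix; $\|\cdot\|_\infty$ is the $\ell_\infty$-norm (maximum modulus of the entries). $\mathrm{diag}(X)$ is the vector of diagonal entries of a matrix $X$; $\mathrm{Diag}(x)$ is the diagonal matrix with diagonal $x$. $\theta_k=2(k-1)\pi/M$ for $k=1,\ldots,M$, and $\mathcal{X}=\{\exp(\mathrm{i}\theta_k): k=1,\ldots,M\}$. $Q=H^\dagger H$, $c=-H^\dagger r$. $\widehat Q=\begin{bmatrix}\mathrm{Re}(Q)&-\mathrm{Im}(Q)\\ \mathrm{Im}(Q)&\mathrm{Re}(Q)\end{bmatrix}\in\mathbb{R}^{2n\times 2n}$, $\hat c=\begin{bmatrix}\mathrm{Re}(c)\\ \mathrm{Im}(c)\end{bmatrix}\in\mathbb{R}^{2n}$. $\alpha=(\cos\theta_1,\ldots,\cos\theta_M)^\top$, $\beta=(\sin\theta_1,\ldots,\sin\theta_M)^\top\in\mathbb{R}^M$. $A=I\otimes\alpha^\top$, $B=I\otimes\beta^\top\in\mathbb{R}^{n\times nM}$ ($I$ the $n\times n$ identity, $\otimes$ the Kronecker product), $P=\begin{bmatrix}A\\ B\end{bmatrix}\in\mathbb{R}^{2n\times nM}$, $G=P^\top\widehat QP\in\mathbb{R}^{nM\times nM}$, $w=P^\top\hat c\in\mathbb{R}^{nM}$. $G$ is partitioned into $n\times n$ blocks $S_{jk}\in\mathbb{R}^{M\times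 M}$; $\widetilde D=\mathrm{Diag}(S_{11},\ldots,S_{nn})$ is the block-diagonal matrix of the diagonal blocks, and $\widetilde G=G-\widetilde D$. A vector $t\in\mathbb{R}^{nM}$ is partitioned as $t=(\bar t_1^\top,\ldots,\bar t_n^\top)^\top$ with blocks $\bar t_j\in\mathbb{R}^M$. $\boldsymbol{e}$ is the all-ones vector, and $t\geqslant0$ is entrywise. For $x\in\mathcal{X}^n$, the vector $t\in\{0,1\}^{nM}$ corresponding to $x$ is the assignment vector with $(\bar t_j)_k=1$ if $x_j=\exp(\mathrm{i}\theta_k)$ and $(\bar t_j)_k=0$ otherwise; it satisfies $\begin{bmatrix}\mathrm{Re}(x)\\ \mathrm{Im}(x)\end{bmatrix}=Pt$. PN-QP method: fix a number $K\geqslant1$ and let $\mathbf{B}=\{t\in\mathbb{R}^{nM}: 0\leqslant t_\ell\leqslant K,\ \ell=1,\ldots,nM\}$, with $\Pi_{\mathbf{B}}$ the Euclidean projection onto $\mathbf{B}$. For $\omega>0$ let $f_\omega(t)=f(t)+\frac{\omega}{2}\sum_{j=1}^n(\boldsymbol{e}^\top\bar t_j-1)^2$. Given $\rho>1$, an initial penalty parameter $\omega_1>0$, penalty parameters $\omega_{k+1}=\rho\,\omega_k$ (so $\omega_k\uparrow+\infty$), and tolerances $\tau_k\downarrow0$, the method generates for each $k\geqslant1$ an approximate solution $t^k\in\mathbf{B}$ of $\min_{t\in\mathbf{B}}f_{\omega_k}(t)$ satisfying $$\|t^k-\Pi_{\mathbf{B}}(t^k-\nabla f_{\omega_k}(t^k))\|_2\leqslant\tau_k.$$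 The sequence generated by the method is any such infinite sequence $\{t^k\}_{k\geqslant1}$. *)

theory Defs
  imports "HOL-Analysis.Analysis"
begin

text \<open>
  Dimensions are index types: \<open>'m\<close> and \<open>'n\<close> index the rows and columns of \<open>H\<close>, and
  \<open>'M\<close> is the index type of the blocks, with \<open>M = CARD('M)\<close>. Since an abstract finite type has
  no preferred enumeration, a bijection \<open>idx\<close> from \<open>'M\<close> onto \<open>{1..M}\<close> is carried as a parameter;
  it says which entry of a vector over \<open>'M\<close> is the \<open>k\<close>-th one.
  A vector in $R^{nM}$ is indexed by \<open>'n \<times> 'M\<close>, its entry \<open>(j, k)\<close> being entry \<open>k\<close> of block \<open>j\<close>;
  a vector in $R^{2n}$ is indexed by \<open>'n + 'n\<close>. On vectors the library's constant \<open>1\<close> is the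
  all-ones vector, so \<open>1 \<bullet> x\<close> is the sum of the entries of \<open>x\<close>.
\<close>

section \<open>Matrices\<close>

definition conj_transpose :: "complex ^ 'c ^ 'r \<Rightarrow> complex ^ 'r ^ 'c" where
  "conj_transpose A = (\<chi> i j. cnj (A $ j $ i))"

definition mat_Re :: "complex ^ 'c ^ 'r \<Rightarrow> real ^ 'c ^ 'r" where
  "mat_Re A = (\<chi> i j. Re (A $ i $ j))"

definition mat_Im :: "complex ^ 'c ^ 'r \<Rightarrow> real ^ 'c ^ 'r" where
  "mat_Im A = (\<chi> i j. Im (A $ i $ j))"

definition vec_Re :: "complex ^ 'r \<Rightarrow> real ^ 'r" where
  "vec_Re x = (\<chi> i. Re (x $ i))"

definition vec_Im :: "complex ^ 'r \<Rightarrow> real ^ 'r" where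
  "vec_Im x = (\<chi> i. Im (x $ i))"

definition diag_of :: "'a ^ 'n ^ 'n \<Rightarrow> 'a ^ 'n" where
  "diag_of X = (\<chi> i. X $ i $ i)"

definition Diag :: "'a::zero ^ 'n \<Rightarrow> 'a ^ 'n ^ 'n" where
  "Diag x = (\<chi> i j. if i = j then x $ i else 0)"

text \<open>
  For a Hermitian matrix all eigenvalues are real, so the real eigenvalues collected here are all
  of them (a finite nonempty set).
\<close>
definition lambda_min :: "complex ^ 'n ^ 'n \<Rightarrow> real" where
  "lambda_min A = Min {l::real. \<exists>x. x \<noteq> 0 \<and> A *v x = complex_of_real l *s x}"

text \<open>
  The library's \<open>infnorm\<close> would take the maximum over real and imaginary parts instead of over
  moduli.
\<close>
definition linf_norm :: "complex ^ 'n \<Rightarrow> real" where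
  "linf_norm x = Max (range (\<lambda>i. cmod (x $ i)))"

text \<open>Stacking; it applies to vectors and, entries being rows, to matrices.\<close>
definition vstack :: "'a ^ 'r \<Rightarrow> 'a ^ 's \<Rightarrow> 'a ^ ('r::finite + 's::finite)" where
  "vstack A B = (\<chi> i. case i of Inl a \<Rightarrow> A $ a | Inr b \<Rightarrow> B $ b)"

definition hstack :: "'a ^ 'c ^ 'r \<Rightarrow> 'a ^ 'd ^ 'r \<Rightarrow> 'a ^ ('c::finite + 'd::finite) ^ 'r" where
  "hstack A B = (\<chi> i. vstack (A $ i) (B $ i))"

definition kronecker ::
  "'a::times ^ 'c ^ 'r \<Rightarrow> 'a ^ 'd ^ 's \<Rightarrow> 'a ^ ('c::finite \<times> 'd::finite) ^ ('r::finite \<times> 's::finite)" where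
  "kronecker A B = (\<chi> p q. A $ fst p $ fst q * B $ snd p $ snd q)"

definition block_diag :: "('n \<Rightarrow> 'a::zero ^ 'k ^ 'k) \<Rightarrow> 'a ^ ('n::finite \<times> 'k::finite) ^ ('n::finite \<times> 'k::finite)" where
  "block_diag S =
     (\<chi> p q. if fst p = fst q then S (fst p) $ snd p $ snd q else 0)"

definition mat_block :: "'a ^ ('n::finite \<times> 'k::finite) ^ ('n::finite \<times> 'k::finite) \<Rightarrow> 'n \<Rightarrow> 'n \<Rightarrow> 'a ^ 'k ^ 'k" where
  "mat_block G i j = (\<chi> a b. G $ (i, a) $ (j, b))"

definition vec_block :: "'a ^ ('n::finite \<times> 'k::finite) \<Rightarrow> 'n \<Rightarrow> 'a ^ 'k" where
  "vec_block t j = (\<chi> k. t $ (j, k))"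


section \<open>The constellation and the assignment vector\<close>

definition theta :: "nat \<Rightarrow> nat \<Rightarrow> real" where
  "theta M k = 2 * (real k - 1) * pi / real M"

definition constellation :: "nat \<Rightarrow> complex set" where
  "constellation M = (\<lambda>k. exp (\<i> * complex_of_real (theta M k))) ` {1..M}"

definition assignment :: "('M::finite \<Rightarrow> nat) \<Rightarrow> complex ^ 'n \<Rightarrow> real ^ ('n::finite \<times> 'M::finite)" where
  "assignment idx x =
     (\<chi> p. if x $ fst p = exp (\<i> * complex_of_real (theta CARD('M) (idx (snd p)))) then 1 else 0)"


section \<open>The quadratic program\<close>

definition alpha :: "('M::finite \<Rightarrow> nat) \<Rightarrow> real ^ 'M" where
  "alpha idx = (\<chi> k. cos (theta CARD('M) (idx k)))"

definition beta :: "('M::finite \<Rightarrow> nat) \<Rightarrow> real ^ 'M" where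
  "beta idx = (\<chi> k. sin (theta CARD('M) (idx k)))"

text \<open>
  The Kronecker product with a row vector has row index type \<open>'n \<times> 1\<close>, identified with \<open>'n\<close>.
\<close>
definition kronecker_row :: "real ^ 'M \<Rightarrow> real ^ ('n::finite \<times> 'M::finite) ^ 'n" where
  "kronecker_row a =
     (\<chi> i. kronecker (mat 1 :: real ^ 'n ^ 'n) (rowvector a :: real ^ 'M ^ 1) $ (i, 1))"

definition P_mat :: "('M::finite \<Rightarrow> nat) \<Rightarrow> real ^ ('n::finite \<times> 'M::finite) ^ ('n::finite + 'n)" where
  "P_mat idx = vstack (kronecker_row (alpha idx)) (kronecker_row (beta idx))"

definition Q_mat :: "complex ^ 'n ^ 'm \<Rightarrow> complex ^ 'n ^ 'n" where
  "Q_mat H = conj_transpose H ** H"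

definition c_vec :: "complex ^ 'n ^ 'm \<Rightarrow> complex ^ 'm \<Rightarrow> complex ^ 'n" where
  "c_vec H r = - (conj_transpose H *v r)"

definition Q_hat :: "complex ^ 'n ^ 'm \<Rightarrow> real ^ ('n + 'n) ^ ('n::finite + 'n)" where
  "Q_hat H = vstack (hstack (mat_Re (Q_mat H)) (- mat_Im (Q_mat H)))
                    (hstack (mat_Im (Q_mat H)) (mat_Re (Q_mat H)))"

definition c_hat :: "complex ^ 'n ^ 'm \<Rightarrow> complex ^ 'm \<Rightarrow> real ^ ('n::finite + 'n)" where
  "c_hat H r = vstack (vec_Re (c_vec H r)) (vec_Im (c_vec H r))"

definition G_mat ::
  "('M::finite \<Rightarrow> nat) \<Rightarrow> complex ^ 'n ^ 'm \<Rightarrow> real ^ ('n::finite \<times> 'M::finite) ^ ('n::finite \<times> 'M::finite)" where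
  "G_mat idx H = transpose (P_mat idx) ** Q_hat H ** P_mat idx"

definition w_vec ::
  "('M::finite \<Rightarrow> nat) \<Rightarrow> complex ^ 'n ^ 'm \<Rightarrow> complex ^ 'm \<Rightarrow> real ^ ('n::finite \<times> 'M::finite)" where
  "w_vec idx H r = transpose (P_mat idx) *v c_hat H r"

definition D_tilde ::
  "('M::finite \<Rightarrow> nat) \<Rightarrow> complex ^ 'n ^ 'm \<Rightarrow> real ^ ('n::finite \<times> 'M::finite) ^ ('n::finite \<times> 'M::finite)" where
  "D_tilde idx H = block_diag (\<lambda>j. mat_block (G_mat idx H) j j)"

definition G_tilde ::
  "('M::finite \<Rightarrow> nat) \<Rightarrow> complex ^ 'n ^ 'm \<Rightarrow> real ^ ('n::finite \<times> 'M::finite) ^ ('n::finite \<times> 'M::finite)" where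
  "G_tilde idx H = G_mat idx H - D_tilde idx H"

definition objective ::
  "('M::finite \<Rightarrow> nat) \<Rightarrow> complex ^ 'n ^ 'm \<Rightarrow> complex ^ 'm \<Rightarrow> real ^ ('n::finite \<times> 'M::finite) \<Rightarrow> real" where
  "objective idx H r t = t \<bullet> (G_tilde idx H *v t) + 2 * (w_vec idx H r \<bullet> t)"

definition rsqp_feasible :: "real ^ ('n::finite \<times> 'M::finite) \<Rightarrow> bool" where
  "rsqp_feasible t \<longleftrightarrow> (\<forall>j. 1 \<bullet> vec_block t j = 1) \<and> (\<forall>p. t $ p \<ge> 0)"


section \<open>The quadratic penalty method\<close>

definition penalty_objective ::
  "('M::finite \<Rightarrow> nat) \<Rightarrow> complex ^ 'n ^ 'm \<Rightarrow> complex ^ 'm \<Rightarrow> real \<Rightarrow> real ^ ('n::finite \<times> 'M::finite) \<Rightarrow> real"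
where
  "penalty_objective idx H r om t =
     objective idx H r t + om / 2 * (\<Sum>j\<in>UNIV. (1 \<bullet> vec_block t j - 1)\<^sup>2)"

definition gradient :: "('a::real_inner \<Rightarrow> real) \<Rightarrow> 'a \<Rightarrow> 'a" where
  "gradient f x = (THE D. GDERIV f x :> D)"

definition box_set :: "real \<Rightarrow> (real ^ 'i) set" where
  "box_set K = {t. \<forall>l. 0 \<le> t $ l \<and> t $ l \<le> K}"

text \<open>
  The iterates, penalty parameters \<open>om\<close> and tolerances \<open>\<tau>\<close> are indexed from 1; their values at
  0 are irrelevant.
\<close>
definition pnqp_sequence ::
  "('M::finite \<Rightarrow> nat) \<Rightarrow> complex ^ 'n ^ 'm \<Rightarrow> complex ^ 'm \<Rightarrow> real \<Rightarrow> real \<Rightarrow>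
   (nat \<Rightarrow> real) \<Rightarrow> (nat \<Rightarrow> real) \<Rightarrow> (nat \<Rightarrow> real ^ ('n::finite \<times> 'M::finite)) \<Rightarrow> bool" where
  "pnqp_sequence idx H r K \<rho> om \<tau> t \<longleftrightarrow>
     K \<ge> 1 \<and> \<rho> > 1 \<and>
     om 1 > 0 \<and> (\<forall>k\<ge>1. om (Suc k) = \<rho> * om k) \<and>
     (\<forall>k\<ge>1. \<tau> (Suc k) \<le> \<tau> k) \<and> \<tau> \<longlonglongrightarrow> 0 \<and>
     (\<forall>k\<ge>1. t k \<in> box_set K \<and>
        norm (t k - closest_point (box_set K)
                (t k - gradient (penalty_objective idx H r (om k)) (t k))) \<le> \<tau> k)"

end

theory Submission
  imports Defs
begin

text \<open>
  Write \<open>z\<close> for the complex vector represented by a feasible \<open>t\<close>, \<open>x\<close> for the transmitted vector,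
  \<open>d = z - x\<close> and \<open>h = H\<^sup>\<dagger>v\<close>. The gradient of the objective at \<open>t\<close>, tested against \<open>(t - t\<^sup>*) / 2\<close>, is
  \<open>d \<bullet> (Q d) - (\<Sum>j. Q\<^sub>j\<^sub>j (d\<^sub>j \<bullet> z\<^sub>j)) - d \<bullet> h\<close>. Since every \<open>x\<^sub>j\<close> has modulus 1 and every \<open>z\<^sub>j\<close>
  lies in the polygon spanned by the constellation, this is at least
  \<open>(\<Sum>j. 2 \<mu> (1 - x\<^sub>j \<bullet> z\<^sub>j) - \<bar>h\<^sub>j\<bar> \<bar>d\<^sub>j\<bar>)\<close> with \<open>\<mu>\<close> the least eigenvalue of \<open>Qbar\<close>, and the angle of the
  polygon at the vertex \<open>x\<^sub>j\<close> gives \<open>1 - x\<^sub>j \<bullet> z\<^sub>j \<ge> sin (\<pi> / M) \<bar>d\<^sub>j\<bar>\<close>. So \<open>t\<^sup>*\<close> is the only feasible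
  point at which the derivative in the direction of \<open>t\<^sup>*\<close> is nonnegative. Minimizers and limit points of the
  penalty method are such points.
\<close>

section \<open>Least eigenvalues of Hermitian matrices\<close>

text \<open>A minimizer of the quadratic form on the unit sphere is an eigenvector: otherwise a
  small step against the residual \<open>f x - l *\<^sub>R x\<close> would lower the Rayleigh
  quotient.\<close>

lemma selfadjoint_Rayleigh_min:
  fixes f :: "'a::euclidean_space \<Rightarrow> 'a"
  assumes lin: "linear f" and adj: "\<And>x y. x \<bullet> f y = f x \<bullet> y"
  obtains l x where "x \<noteq> 0" "f x = l *\<^sub>R x" "\<And>y. l * (y \<bullet> y) \<le> y \<bullet> f y"
proof -
  have "compact (sphere (0::'a) 1)" "sphere (0::'a) 1 \<noteq> {}"
    using vector_choose_size[of 1, where 'a='a] by auto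
  moreover have "continuous_on (sphere 0 1) (\<lambda>x. x \<bullet> f x)"
    by (intro continuous_intros linear_continuous_on_compose[OF _ lin])
  ultimately obtain x where x: "norm x = 1" 
    and min: "\<And>y. norm y = 1 \<Longrightarrow> x \<bullet> f x \<le> y \<bullet> f y"
    using continuous_attains_inf[of "sphere 0 1" "\<lambda>x. x \<bullet> f x"] by auto
  define l where "l = x \<bullet> f x"
  have xx: "x \<bullet> x = 1" using x by (simp add: dot_square_norm)
  have le: "l * (y \<bullet> y) \<le> y \<bullet> f y" for y
  proof (cases "y = 0")
    case False
    define c where "c = inverse (norm y)"
    have "norm (c *\<^sub>R y) = 1" "c > 0" using False by (auto simp: c_def)
    from min[OF this(1)] have "l \<le> c\<^sup>2 * (y \<bullet> f y)"
      by (simp add: l_def linear_cmul[OF lin] power2_eq_square)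
    moreover have "c\<^sup>2 * (y \<bullet> y) = 1"
      using False by (simp add: c_def dot_square_norm power_inverse)
    ultimately have "c\<^sup>2 * (l * (y \<bullet> y)) \<le> c\<^sup>2 * (y \<bullet> f y)"
      by (simp add: algebra_simps)
    then show ?thesis using \<open>c > 0\<close> by simp
  qed (simp add: linear_0[OF lin])
  define g where "g = f x - l *\<^sub>R x"
  define b where "b = g \<bullet> f g - l * (g \<bullet> g)"
  have b: "b \<ge> 0" using le[of g] by (simp add: b_def)
  have q: "0 \<le> - 2 * e * (g \<bullet> g) + e\<^sup>2 * b" for e
  proof -
    have "x \<bullet> f g = g \<bullet> f x" by (metis adj inner_commute)
    moreover have "g \<bullet> g = g \<bullet> f x - l * (g \<bullet> x)"
      by (subst (2) g_def) (simp add: inner_diff_right)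
    moreover have "(x - e *\<^sub>R g) \<bullet> f (x - e *\<^sub>R g) = l - e * (g \<bullet> f x) - e * (x \<bullet> f g) + e\<^sup>2 * (g \<bullet> f g)"
      by (simp add: linear_diff[OF lin] linear_cmul[OF lin] inner_simps l_def power2_eq_square
          algebra_simps)
    moreover have "(x - e *\<^sub>R g) \<bullet> (x - e *\<^sub>R g) = 1 - 2 * e * (g \<bullet> x) + e\<^sup>2 * (g \<bullet> g)"
      by (simp add: inner_simps xx power2_eq_square inner_commute)
    ultimately have "l * (1 - 2 * e * (g \<bullet> x) + e\<^sup>2 * (g \<bullet> g))
        \<le> l - 2 * e * (g \<bullet> g + l * (g \<bullet> x)) + e\<^sup>2 * (g \<bullet> f g)"
      using le[of "x - e *\<^sub>R g"] by simp
    then show ?thesis by (simp add: b_def algebra_simps)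
  qed
  have "g \<bullet> g = 0"
  proof -
    \<comment> \<open>This step size turns \<open>e\<^sup>2 * b\<close> into
      \<open>e * (g \<bullet> g) - e\<^sup>2\<close>, so the quadratic in \<open>q\<close> is at
      most \<open>- e\<^sup>2\<close>; the \<open>+ 1\<close> covers the case
      \<open>b = 0\<close>.\<close>
    define e where "e = (g \<bullet> g) / (b + 1)"
    have "e * (b + 1) = g \<bullet> g" using b by (simp add: e_def)
    then have "e\<^sup>2 * b = e * (g \<bullet> g) - e\<^sup>2"
      by (simp add: power2_eq_square algebra_simps flip: \<open>e * (b + 1) = g \<bullet> g\<close>)
    then have "0 \<le> - e * (g \<bullet> g) - e\<^sup>2" using q[of e] by simp
    moreover have "e \<ge> 0" using b by (simp add: e_def)
    then have "0 \<le> e * (g \<bullet> g)" by simp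
    ultimately have "e\<^sup>2 \<le> 0" by linarith
    then have "e = 0" by simp
    then show ?thesis using \<open>e * (b + 1) = g \<bullet> g\<close> by simp
  qed
  then have "f x = l *\<^sub>R x" by (simp add: g_def)
  moreover have "x \<noteq> 0" using x by auto
  ultimately show thesis using le that by blast
qed

text \<open>Eigenvectors for distinct eigenvalues are orthogonal, and pairwise orthogonal sets in a
  Euclidean space are finite. This finiteness gives \<open>Min\<close> in \<open>lambda_min\<close>
  its meaning.\<close>

lemma selfadjoint_finite_eigenvalues:
  fixes f :: "'a::euclidean_space \<Rightarrow> 'a"
  assumes adj: "\<And>x y. x \<bullet> f y = f x \<bullet> y"
  shows "finite {l. \<exists>x. x \<noteq> 0 \<and> f x = l *\<^sub>R x}" (is "finite ?E")
proof -
  obtain e where e: "\<And>l. l \<in> ?E \<Longrightarrow> e l \<noteq> 0 \<and> f (e l) = l *\<^sub>R e l"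
  proof
    show "(SOME x. x \<noteq> 0 \<and> f x = l *\<^sub>R x) \<noteq> 0 \<and>
        f (SOME x. x \<noteq> 0 \<and> f x = l *\<^sub>R x) = l *\<^sub>R (SOME x. x \<noteq> 0 \<and> f x = l *\<^sub>R x)"
      if "l \<in> ?E" for l
      using that by (intro someI_ex[of "\<lambda>x. x \<noteq> 0 \<and> f x = l *\<^sub>R x"]) simp
  qed
  have orth: "e l \<bullet> e m = 0" if "l \<in> ?E" "m \<in> ?E" "l \<noteq> m" for l m
  proof -
    have "e l \<bullet> f (e m) = f (e l) \<bullet> e m" by (rule adj)
    then show ?thesis using e that by simp
  qed
  have "inj_on e ?E"
  proof (intro inj_onI, rule ccontr)
    fix l m assume lm: "l \<in> ?E" "m \<in> ?E" "e l = e m" "l \<noteq> m"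
    show False using orth[OF lm(1,2,4)] e[OF lm(1)] lm(3) by simp
  qed
  moreover have "pairwise orthogonal (e ` ?E)"
    unfolding orthogonal_def by (intro pairwise_imageI orth)
  then have "finite (e ` ?E)"
    by (rule pairwise_orthogonal_imp_finite)
  ultimately show ?thesis by (simp add: finite_image_iff)
qed

text \<open>On complex vectors \<open>\<bullet>\<close> is the real part of the Hermitian product,
  and its adjoint is still the conjugate transpose. Hermitian matrices thus become self-adjoint maps
  of a real Euclidean space.\<close>

lemma inner_matrix_vector_mult_cnj:
  fixes A :: "complex ^ 'c::finite ^ 'r::finite"
  shows "x \<bullet> (A *v y) = (conj_transpose A *v x) \<bullet> y"
proof -
  have "x \<bullet> (A *v y) = (\<Sum>i\<in>UNIV. \<Sum>j\<in>UNIV. x $ i \<bullet> (A $ i $ j * y $ j))"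
    by (simp add: inner_vec_def matrix_vector_mult_def inner_sum_right)
  also have "\<dots> = (\<Sum>j\<in>UNIV. \<Sum>i\<in>UNIV. x $ i \<bullet> (A $ i $ j * y $ j))"
    by (rule sum.swap)
  also have "\<dots> = (\<Sum>j\<in>UNIV. \<Sum>i\<in>UNIV. (cnj (A $ i $ j) * x $ i) \<bullet> y $ j)"
    by (simp add: inner_complex_def algebra_simps)
  also have "\<dots> = (conj_transpose A *v x) \<bullet> y"
    by (simp add: inner_vec_def matrix_vector_mult_def conj_transpose_def inner_sum_left)
  finally show ?thesis .
qed

lemma lambda_min_Rayleigh:
  fixes A :: "complex ^ 'n::finite ^ 'n"
  assumes herm: "conj_transpose A = A"
  shows "lambda_min A * (x \<bullet> x) \<le> x \<bullet> (A *v x)"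
proof -
  have adj: "x \<bullet> (A *v y) = (A *v x) \<bullet> y" for x y
    by (metis herm inner_matrix_vector_mult_cnj)
  have lin: "linear ((*v) A)"
    by (rule linearI) (simp_all add: vec_eq_iff matrix_vector_mult_def scaleR_right.sum
        distrib_left sum.distrib)
  \<comment> \<open>Scaling by a real number is the same in \<open>*s\<close> and
    \<open>*\<^sub>R\<close>, so the set in \<open>lambda_min\<close> is the spectrum of the
    real-linear map.\<close>
  have E: "{l::real. \<exists>x. x \<noteq> 0 \<and> A *v x = complex_of_real l *s x} = {l. \<exists>x. x \<noteq> 0 \<and> A *v x = l *\<^sub>R x}"
    by (simp add: vec_eq_iff scaleR_conv_of_real[where 'a=complex])
  obtain l x0 where l: "x0 \<noteq> 0" "A *v x0 = l *\<^sub>R x0" "\<And>y. l * (y \<bullet> y) \<le> y \<bullet> (A *v y)"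
    using selfadjoint_Rayleigh_min[OF lin adj] by blast
  have "lambda_min A \<le> l"
    unfolding lambda_min_def E using selfadjoint_finite_eigenvalues[OF adj] l by (intro Min_le) auto
  then have "lambda_min A * (x \<bullet> x) \<le> l * (x \<bullet> x)" by (intro mult_right_mono) auto
  with l(3)[of x] show ?thesis by linarith
qed

section \<open>The objective in complex form\<close>

definition symbol :: "('M::finite \<Rightarrow> nat) \<Rightarrow> 'M \<Rightarrow> complex" where
  "symbol idx k = cis (theta CARD('M) (idx k))"

text \<open>The vector \<open>P_mat idx *v t\<close>, with its two halves read as real and imaginary
  parts.\<close>

definition superpose :: "('M::finite \<Rightarrow> nat) \<Rightarrow> real ^ ('n::finite \<times> 'M::finite) \<Rightarrow> complex ^ 'n" where
  "superpose idx t = (\<chi> j. \<Sum>k\<in>UNIV. t $ (j, k) *\<^sub>R symbol idx k)"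

section \<open>The real matrices of the program as complex linear maps\<close>

lemma sum_UNIV_sum:
  fixes g :: "'a::finite + 'b::finite \<Rightarrow> 'c::comm_monoid_add"
  shows "sum g UNIV = (\<Sum>a\<in>UNIV. g (Inl a)) + (\<Sum>b\<in>UNIV. g (Inr b))"
  by (simp flip: UNIV_Plus_UNIV add: sum.Plus comp_def)

lemma sum_UNIV_prod:
  fixes g :: "'a::finite \<times> 'b::finite \<Rightarrow> 'c::comm_monoid_add"
  shows "sum g UNIV = (\<Sum>a\<in>UNIV. \<Sum>b\<in>UNIV. g (a, b))"
  by (simp flip: UNIV_Times_UNIV add: sum.cartesian_product)

lemma kronecker_row_nth: "kronecker_row a $ i $ (j, k) = (if i = j then a $ k else 0)"
  by (simp add: kronecker_row_def kronecker_def mat_def rowvector_def)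

lemma vstack_nth [simp]: "vstack a b $ Inl i = a $ i" "vstack a b $ Inr j = b $ j"
  by (simp_all add: vstack_def)

lemma kronecker_row_mult:
  "(kronecker_row a *v t) $ j = (\<Sum>k\<in>UNIV. t $ (j, k) * a $ k)"
  by (simp add: matrix_vector_mult_def sum_UNIV_prod kronecker_row_nth mult_delta_left)
     (subst sum.swap, simp add: mult.commute)

lemma vstack_mult: "vstack A B *v t = vstack (A *v t) (B *v t)"
  by (simp add: vec_eq_iff matrix_vector_mult_def vstack_def split: sum.split)

lemma hstack_mult:
  fixes A :: "real ^ 'a::finite ^ 'r::finite"
  shows "hstack A B *v vstack x y = A *v x + B *v y"
  by (simp add: vec_eq_iff matrix_vector_mult_def hstack_def sum_UNIV_sum)

lemma P_mat_mult:
  "P_mat idx *v t = vstack (vec_Re (superpose idx t)) (vec_Im (superpose idx t))"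
  unfolding P_mat_def vstack_mult
  by (intro arg_cong2[where f=vstack])
     (simp_all add: vec_eq_iff kronecker_row_mult vec_Re_def vec_Im_def superpose_def
       symbol_def alpha_def beta_def)

lemma Q_hat_mult:
  "Q_hat H *v vstack (vec_Re z) (vec_Im z) =
     vstack (vec_Re (Q_mat H *v z)) (vec_Im (Q_mat H *v z))"
  unfolding Q_hat_def vstack_mult hstack_mult
  by (intro arg_cong2[where f=vstack])
     (simp_all add: vec_eq_iff vec_Re_def vec_Im_def mat_Re_def mat_Im_def
       matrix_vector_mult_def sum_subtractf sum.distrib sum_negf add.commute)

lemma P_mat_transpose_mult:
  "(transpose (P_mat idx) *v vstack (vec_Re y) (vec_Im y)) $ (j, k) = y $ j \<bullet> symbol idx k"
  by (simp add: matrix_vector_mult_def sum_UNIV_sum transpose_def P_mat_def kronecker_row_nth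
      mult_delta_left mult_delta_right vec_Re_def vec_Im_def symbol_def alpha_def beta_def
      inner_complex_def mult.commute del: transpose_matrix_vector)

lemma G_mat_mult:
  "(G_mat idx H *v t) $ (j, k) = (Q_mat H *v superpose idx t) $ j \<bullet> symbol idx k"
  by (simp add: G_mat_def P_mat_mult Q_hat_mult P_mat_transpose_mult
      del: transpose_matrix_vector flip: matrix_vector_mul_assoc)

lemma w_vec_nth: "w_vec idx H r $ (j, k) = c_vec H r $ j \<bullet> symbol idx k"
  by (simp add: w_vec_def c_hat_def P_mat_transpose_mult del: transpose_matrix_vector)

text \<open>Masking \<open>t\<close> outside block \<open>j\<close> expresses the block-diagonal
  part through \<open>G\<close> itself, so that \<open>G_mat_mult\<close> applies to it.\<close>

lemma block_diag_mult:
  fixes G :: "real ^ ('n::finite \<times> 'M::finite) ^ ('n \<times> 'M)"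
  shows "(block_diag (\<lambda>j. mat_block G j j) *v t) $ (j, k) =
    (G *v (\<chi> p. if fst p = j then t $ p else 0)) $ (j, k)"
  by (simp add: matrix_vector_mult_def block_diag_def mat_block_def)
     (intro sum.cong, auto)

lemma superpose_block:
  "superpose idx (\<chi> p. if fst p = j then t $ p else 0) = axis j (superpose idx t $ j)"
  by (simp add: vec_eq_iff superpose_def axis_def)

lemma Diag_mult:
  fixes x :: "'a::semiring_1 ^ 'n"
  shows "Diag x *v y = (\<chi> i. x $ i * y $ i)"
  by (simp add: vec_eq_iff matrix_vector_mult_def Diag_def mult_delta_left)

text \<open>The masked vector superposes to a multiple of the coordinate vector \<open>j\<close>,
  which row \<open>j\<close> of \<open>Q_mat H\<close> meets only in its diagonal entry. Removing
  the diagonal blocks of \<open>G_mat idx H\<close> is therefore removing the diagonal of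
  \<open>Q_mat H\<close>.\<close>

lemma G_tilde_mult:
  "(G_tilde idx H *v t) $ (j, k) =
     ((Q_mat H - Diag (diag_of (Q_mat H))) *v superpose idx t) $ j \<bullet> symbol idx k"
proof -
  have "(D_tilde idx H *v t) $ (j, k) = (Diag (diag_of (Q_mat H)) *v superpose idx t) $ j \<bullet> symbol idx k"
    by (simp add: D_tilde_def block_diag_mult G_mat_mult superpose_block Diag_mult diag_of_def)
       (simp add: matrix_vector_mult_def axis_def mult_delta_right)
  then show ?thesis
    by (simp add: G_tilde_def matrix_vector_mult_diff_rdistrib G_mat_mult inner_diff_left)
qed

text \<open>Transfers pairings of assignment-type vectors to complex n-space: the vectors
  \<open>G_tilde idx H *v t\<close> and \<open>w_vec idx H r\<close> both have entries of the
  assumed form.\<close>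

lemma inner_superpose:
  assumes "\<And>j k. g $ (j, k) = y $ j \<bullet> symbol idx k"
  shows "t \<bullet> g = superpose idx t \<bullet> y"
  by (simp add: inner_vec_def sum_UNIV_prod assms superpose_def inner_sum_left inner_commute[of "y $ _"])

section \<open>Hermitian symmetry and the symmetry of the quadratic form\<close>

lemma conj_transpose_Q_mat: "conj_transpose (Q_mat H) = Q_mat H"
  by (simp add: Q_mat_def conj_transpose_def vec_eq_iff matrix_matrix_mult_def mult.commute)

lemma cnj_Q_mat_diag: "cnj (Q_mat H $ j $ j) = Q_mat H $ j $ j"
  using conj_transpose_Q_mat[of H] by (simp add: conj_transpose_def vec_eq_iff)

text \<open>The factor \<open>c\<close> is general because 1 gives the matrix behind
  \<open>G_tilde\<close> and 1/2 gives \<open>Qbar\<close>.\<close>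

lemma conj_transpose_Q_mat_minus_Diag:
  "conj_transpose (Q_mat H - c *\<^sub>R Diag (diag_of (Q_mat H))) = Q_mat H - c *\<^sub>R Diag (diag_of (Q_mat H))"
  using conj_transpose_Q_mat[of H] by (auto simp: conj_transpose_def vec_eq_iff Diag_def diag_of_def)

lemma G_tilde_symmetric: "s \<bullet> (G_tilde idx H *v t) = t \<bullet> (G_tilde idx H *v s)"
proof -
  let ?Q = "Q_mat H - Diag (diag_of (Q_mat H))"
  have "s \<bullet> (G_tilde idx H *v t) = superpose idx s \<bullet> (?Q *v superpose idx t)"
    by (rule inner_superpose) (rule G_tilde_mult)
  also have "\<dots> = (?Q *v superpose idx s) \<bullet> superpose idx t"
    using conj_transpose_Q_mat_minus_Diag[of H 1] by (simp add: inner_matrix_vector_mult_cnj)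
  also have "\<dots> = t \<bullet> (G_tilde idx H *v s)"
    by (subst inner_commute, rule inner_superpose[symmetric]) (rule G_tilde_mult)
  finally show ?thesis .
qed

section \<open>The constellation polygon\<close>

lemma inner_symbol: "symbol idx k \<bullet> symbol (idx :: 'M::finite \<Rightarrow> nat) l =
    cos (theta CARD('M) (idx k) - theta CARD('M) (idx l))"
  by (simp add: symbol_def inner_complex_def cos_diff)

lemma inner_symbol_self [simp]: "symbol idx k \<bullet> symbol idx k = 1"
  by (simp add: inner_symbol)

lemma norm_symbol [simp]: "norm (symbol idx k) = 1"
  by (simp add: symbol_def)

text \<open>The chord has length \<open>2 * sin \<phi>\<close>, where \<open>2 * \<phi>\<close> is
  the difference of the two angles. As \<open>\<phi>\<close> lies between \<pi>/M and \<pi> -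
  \<pi>/M, its sine is smallest at the endpoints.\<close>

lemma symbol_distance:
  fixes idx :: "'M::finite \<Rightarrow> nat"
  assumes bij: "bij_betw idx UNIV {1..CARD('M)}" and "k \<noteq> l"
  shows "2 * sin (pi / CARD('M)) \<le> norm (symbol idx k - symbol idx l)"
proof -
  define M where "M = real CARD('M)"
  define m where "m = \<bar>real (idx k) - real (idx l)\<bar>"
  define \<phi> where "\<phi> = m * (pi / M)"
  have "M > 0" by (simp add: M_def)
  have rng: "idx i \<in> {1..CARD('M)}" for i
    using bij by (auto simp: bij_betw_def)
  have "idx k \<noteq> idx l" using bij \<open>k \<noteq> l\<close> by (auto simp: bij_betw_def inj_on_def)
  then have m: "1 \<le> m" "m \<le> M - 1" using rng[of k] rng[of l] by (auto simp: m_def M_def)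
  have lo: "pi / M \<le> \<phi>" using mult_right_mono[OF m(1), of "pi / M"] \<open>M > 0\<close> by (simp add: \<phi>_def)
  have "\<phi> \<le> (M - 1) * (pi / M)" using mult_right_mono[OF m(2), of "pi / M"] \<open>M > 0\<close> by (simp add: \<phi>_def)
  also have "\<dots> = pi - pi / M" using \<open>M > 0\<close> by (simp add: field_simps)
  finally have hi: "\<phi> \<le> pi - pi / M" .
  have pos: "0 < pi / M" using \<open>M > 0\<close> by simp
  have sin: "sin (pi / M) \<le> sin \<phi>"
  proof (cases "\<phi> \<le> pi / 2")
    case True
    then show ?thesis using lo pos by (intro sin_monotone_2pi_le) auto
  next
    case False
    have "sin (pi / M) \<le> sin (pi - \<phi>)" using False lo hi pos by (intro sin_monotone_2pi_le) auto
    then show ?thesis by simp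
  qed
  have "cos (theta CARD('M) (idx k) - theta CARD('M) (idx l)) = cos (2 * \<phi>)"
  proof -
    have "theta CARD('M) (idx k) - theta CARD('M) (idx l) = (real (idx k) - real (idx l)) * (2 * pi / M)"
      using \<open>M > 0\<close> by (simp add: theta_def M_def field_simps)
    then have "\<bar>theta CARD('M) (idx k) - theta CARD('M) (idx l)\<bar> = 2 * \<phi>"
      using \<open>M > 0\<close> by (simp add: \<phi>_def m_def abs_mult)
    moreover have "cos \<bar>a\<bar> = cos a" for a :: real by (simp add: abs_if)
    ultimately show ?thesis by metis
  qed
  then have "symbol idx k \<bullet> symbol idx l = cos (2 * \<phi>)" by (simp add: inner_symbol)
  then have "(norm (symbol idx k - symbol idx l))\<^sup>2 = 2 - 2 * cos (2 * \<phi>)"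
    by (simp add: power2_norm_eq_inner inner_diff_left inner_diff_right
        inner_commute[of "symbol idx l" "symbol idx k"])
  also have "\<dots> = (2 * sin \<phi>)\<^sup>2" by (simp add: cos_double_sin power_mult_distrib)
  finally have eq: "(norm (symbol idx k - symbol idx l))\<^sup>2 = (2 * sin \<phi>)\<^sup>2" .
  have "0 \<le> sin \<phi>" using lo hi pos by (intro sin_ge_zero) auto
  then have "0 \<le> 2 * sin \<phi>" by simp
  with eq have "norm (symbol idx k - symbol idx l) = 2 * sin \<phi>"
    by (rule power2_eq_imp_eq[OF _ norm_ge_zero])
  then show ?thesis using sin by (simp add: M_def)
qed

text \<open>For unit vectors at distance \<open>\<delta>\<close> the right side is half of
  \<open>\<delta> * \<delta>\<close>; one of the two factors is bounded below by the shortest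
  chord.\<close>

lemma symbol_cone:
  fixes idx :: "'M::finite \<Rightarrow> nat"
  assumes bij: "bij_betw idx UNIV {1..CARD('M)}"
  shows "sin (pi / CARD('M)) * norm (symbol idx k - symbol idx l) \<le> 1 - symbol idx k \<bullet> symbol idx l"
proof (cases "k = l")
  case False
  define \<delta> where "\<delta> = norm (symbol idx k - symbol idx l)"
  have "2 * sin (pi / CARD('M)) * \<delta> \<le> \<delta> * \<delta>"
    using symbol_distance[OF bij False] by (intro mult_right_mono) (auto simp: \<delta>_def)
  also have "\<dots> = 2 * (1 - symbol idx k \<bullet> symbol idx l)"
    by (simp add: \<delta>_def power2_norm_eq_inner inner_diff_left inner_diff_right
        inner_commute[of "symbol idx l" "symbol idx k"] flip: power2_eq_square)
  finally show ?thesis by (simp add: \<delta>_def)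
qed simp

text \<open>The left side is convex in the polygon point and the right side is affine, so the
  inequality passes from the vertices to their convex combinations.\<close>

lemma polygon_cone:
  fixes idx :: "'M::finite \<Rightarrow> nat"
  assumes bij: "bij_betw idx UNIV {1..CARD('M)}"
    and c: "\<And>k. c k \<ge> 0" "sum c UNIV = 1"
  shows "sin (pi / CARD('M)) * norm (symbol idx l - (\<Sum>k\<in>UNIV. c k *\<^sub>R symbol idx k))
    \<le> 1 - symbol idx l \<bullet> (\<Sum>k\<in>UNIV. c k *\<^sub>R symbol idx k)"
proof -
  let ?s = "sin (pi / CARD('M))"
  have s: "?s \<ge> 0" by (intro sin_ge_zero) (auto simp: field_simps)
  have "symbol idx l - (\<Sum>k\<in>UNIV. c k *\<^sub>R symbol idx k) = (\<Sum>k\<in>UNIV. c k *\<^sub>R (symbol idx l - symbol idx k))"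
    by (simp add: scaleR_diff_right sum_subtractf c flip: scaleR_sum_left)
  then have "?s * norm (symbol idx l - (\<Sum>k\<in>UNIV. c k *\<^sub>R symbol idx k))
      \<le> ?s * (\<Sum>k\<in>UNIV. norm (c k *\<^sub>R (symbol idx l - symbol idx k)))"
    using s by (simp only: norm_sum mult_left_mono)
  also have "\<dots> = (\<Sum>k\<in>UNIV. c k * (?s * norm (symbol idx l - symbol idx k)))"
    using c by (simp add: sum_distrib_left ac_simps)
  also have "\<dots> \<le> (\<Sum>k\<in>UNIV. c k * (1 - symbol idx l \<bullet> symbol idx k))"
    by (intro sum_mono mult_left_mono symbol_cone bij c)
  also have "\<dots> = 1 - symbol idx l \<bullet> (\<Sum>k\<in>UNIV. c k *\<^sub>R symbol idx k)"
    by (simp add: right_diff_distrib sum_subtractf c inner_sum_right)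
  finally show ?thesis .
qed

text \<open>Each vertex is exposed by its own functional: the inner product with
  \<open>symbol idx l\<close> is below 1 at every other vertex, so a convex combination reaching 1
  puts no weight there.\<close>

lemma polygon_vertex:
  fixes idx :: "'M::finite \<Rightarrow> nat"
  assumes M: "CARD('M) \<ge> 2" and bij: "bij_betw idx UNIV {1..CARD('M)}"
    and c: "\<And>k. c k \<ge> 0" "sum c UNIV = 1"
    and eq: "(\<Sum>k\<in>UNIV. c k *\<^sub>R symbol idx k) = symbol idx l"
  shows "c k = (if k = l then 1 else 0)"
proof -
  let ?s = "sin (pi / CARD('M))"
  have s: "?s > 0" using M by (intro sin_gt_zero) (auto simp: field_simps)
  have nn: "c k * (1 - symbol idx l \<bullet> symbol idx k) \<ge> 0" for k
    using norm_cauchy_schwarz[of "symbol idx l" "symbol idx k"] c by simp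
  have "(\<Sum>k\<in>UNIV. c k * (1 - symbol idx l \<bullet> symbol idx k)) = 1 - symbol idx l \<bullet> (\<Sum>k\<in>UNIV. c k *\<^sub>R symbol idx k)"
    by (simp add: right_diff_distrib sum_subtractf c inner_sum_right)
  also have "\<dots> = 0" by (simp add: eq)
  finally have z: "c k * (1 - symbol idx l \<bullet> symbol idx k) = 0" for k
    using nn by (simp add: sum_nonneg_eq_0_iff)
  have off: "c k = 0" if "k \<noteq> l" for k
  proof -
    have "norm (symbol idx l - symbol idx k) > 0"
      using symbol_distance[OF bij, of l k] not_sym[OF that] s by linarith
    with s have "0 < ?s * norm (symbol idx l - symbol idx k)" by (rule mult_pos_pos)
    with symbol_cone[OF bij, of l k] have "1 - symbol idx l \<bullet> symbol idx k > 0" by linarith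
    with z[of k] show ?thesis by simp
  qed
  have "sum c UNIV = (\<Sum>k\<in>UNIV. if k = l then c l else 0)"
    by (intro sum.cong) (auto simp: off)
  then have "c l = 1" using c by simp
  with off show ?thesis by simp
qed

lemma assignment_symbols:
  fixes idx :: "'M::finite \<Rightarrow> nat"
  assumes M: "CARD('M) \<ge> 2" and bij: "bij_betw idx UNIV {1..CARD('M)}"
    and x: "\<And>j. x $ j \<in> constellation CARD('M)"
  obtains \<kappa> where "\<And>j. x $ j = symbol idx (\<kappa> j)"
    "\<And>j k. assignment idx x $ (j, k) = (if k = \<kappa> j then 1 else 0)"
proof -
  have sym: "symbol idx k = exp (\<i> * complex_of_real (theta CARD('M) (idx k)))" for k
    by (simp add: symbol_def cis_conv_exp)
  have "\<exists>k. x $ j = symbol idx k" for j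
    using x[of j] bij unfolding constellation_def sym bij_betw_def
    by (metis (no_types, lifting) imageE)
  then obtain \<kappa> where \<kappa>: "x $ j = symbol idx (\<kappa> j)" for j by metis
  have s: "sin (pi / CARD('M)) > 0" using M by (intro sin_gt_zero) (auto simp: field_simps)
  have "symbol idx l = symbol idx k \<longleftrightarrow> k = l" for k l
    using symbol_distance[OF bij, of l k] s by (cases "k = l") auto
  then have "assignment idx x $ (j, k) = (if k = \<kappa> j then 1 else 0)" for j k
    unfolding assignment_def by (simp add: \<kappa> flip: sym)
  with \<kappa> show thesis by (rule that)
qed

section \<open>Uniqueness of the stationary point\<close>

lemma one_inner_vec_block: "(1 :: real ^ 'M) \<bullet> vec_block t j = (\<Sum>k\<in>UNIV. t $ (j, k))"
  by (simp add: inner_vec_def vec_block_def)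

lemma norm_le_linf_norm: "norm (x $ i) \<le> linf_norm x"
  unfolding linf_norm_def by (intro Max_ge) auto

lemma superpose_diff: "superpose idx (s - t) = superpose idx s - superpose idx t"
  by (simp add: vec_eq_iff superpose_def scaleR_diff_left sum_subtractf)

lemma stationary_unique:
  fixes H :: "complex ^ 'n::finite ^ 'm::finite" and idx :: "'M::finite \<Rightarrow> nat"
  assumes M: "CARD('M) \<ge> 2" and bij: "bij_betw idx UNIV {1..CARD('M)}"
    and x: "\<And>j. x $ j \<in> constellation CARD('M)"
    and r: "r = H *v x + v"
    and bound: "sqrt 2 * lambda_min (Q_mat H - (1/2) *\<^sub>R Diag (diag_of (Q_mat H))) * sin (pi / CARD('M))
      > linf_norm (conj_transpose H *v v)"
    and feas: "rsqp_feasible t"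
    and vi: "0 \<le> (assignment idx x - t) \<bullet> (G_tilde idx H *v t + w_vec idx H r)"
  shows "t = assignment idx x"
proof -
  obtain \<kappa> where \<kappa>: "\<And>j. x $ j = symbol idx (\<kappa> j)"
    "\<And>j k. assignment idx x $ (j, k) = (if k = \<kappa> j then 1 else 0)"
    using assignment_symbols[OF M bij x] by blast
  define Q where "Q = Q_mat H"
  define Qbar where "Qbar = Q - (1/2) *\<^sub>R Diag (diag_of Q)"
  define \<mu> where "\<mu> = lambda_min Qbar"
  define h where "h = conj_transpose H *v v"
  define N where "N = linf_norm h"
  define s where "s = sin (pi / CARD('M))"
  define z where "z = superpose idx t"
  define d where "d = z - x"
  define q where "q j = Re (Q $ j $ j)" for j
  have s: "s > 0" unfolding s_def using M by (intro sin_gt_zero) (auto simp: field_simps)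
  have "0 \<le> N" unfolding N_def by (rule order_trans[OF norm_ge_zero norm_le_linf_norm])
  then have "0 < sqrt 2 * (\<mu> * s)"
    using bound by (simp add: N_def \<mu>_def s_def Q_def Qbar_def h_def mult.assoc)
  then have \<mu>s: "0 < \<mu> * s" by (simp add: zero_less_mult_iff)
  then have \<mu>: "\<mu> > 0" using s by (simp add: zero_less_mult_iff)
  \<comment> \<open>The final estimate uses the bound with factor 2, which follows from the one with
    \<open>sqrt 2\<close> because \<open>\<mu> * s\<close> is positive.\<close>
  have "sqrt 2 \<le> (2::real)" by (rule real_le_lsqrt) auto
  then have "sqrt 2 * (\<mu> * s) \<le> 2 * (\<mu> * s)" using \<mu>s by (intro mult_right_mono) auto
  then have N: "N < 2 * \<mu> * s"
    using bound by (simp add: N_def \<mu>_def s_def Q_def Qbar_def h_def mult.assoc)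
  have t0: "t $ p \<ge> 0" and t1: "(\<Sum>k\<in>UNIV. t $ (j, k)) = 1" for p j
    using feas unfolding rsqp_feasible_def one_inner_vec_block by blast+
  have zj: "z $ j = (\<Sum>k\<in>UNIV. t $ (j, k) *\<^sub>R symbol idx k)" for j
    by (simp add: z_def superpose_def)
  have z1: "norm (z $ j) \<le> 1" for j
  proof -
    have "norm (z $ j) \<le> (\<Sum>k\<in>UNIV. norm (t $ (j, k) *\<^sub>R symbol idx k))"
      unfolding zj by (rule norm_sum)
    then show ?thesis using t0 t1[of j] by simp
  qed
  have Qjj: "Q $ j $ j = of_real (q j)" for j
    using cnj_Q_mat_diag[of H j] unfolding Q_def q_def by (simp add: complex_eq_iff)
  have ray: "\<mu> * (y \<bullet> y) \<le> y \<bullet> (Qbar *v y)" for y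
    unfolding \<mu>_def using conj_transpose_Q_mat_minus_Diag[of H "1/2"]
    by (intro lambda_min_Rayleigh) (simp add: Qbar_def Q_def)
  have D: "y \<bullet> (Diag (diag_of Q) *v y') = (\<Sum>j\<in>UNIV. q j * (y $ j \<bullet> y' $ j))" for y y'
    by (simp add: inner_vec_def Diag_mult diag_of_def Qjj flip: scaleR_conv_of_real)
  have Qb: "y \<bullet> (Qbar *v y) = y \<bullet> (Q *v y) - 1/2 * (y \<bullet> (Diag (diag_of Q) *v y))" for y
  proof -
    have "((1/2) *\<^sub>R Diag (diag_of Q)) *v y = (1/2) *\<^sub>R (Diag (diag_of Q) *v y)"
      by (simp add: vec_eq_iff matrix_vector_mult_def scaleR_right.sum)
    then show ?thesis by (simp add: Qbar_def matrix_vector_mult_diff_rdistrib inner_diff_right)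
  qed
  \<comment> \<open>The Rayleigh bound is tested on a coordinate vector; the diagonal entries of
    \<open>Qbar\<close> are half those of \<open>Q\<close>.\<close>
  have q: "2 * \<mu> \<le> q j" for j
  proof -
    have ax: "axis j 1 \<bullet> y = Re (y $ j)" for y :: "complex ^ 'n"
      by (simp add: inner_axis' inner_complex_def)
    have "\<mu> \<le> Re ((Qbar *v axis j 1) $ j)"
      using ray[of "axis j 1"] unfolding ax by simp
    also have "(Qbar *v axis j 1) $ j = Qbar $ j $ j"
      by (simp add: matrix_vector_mult_def axis_def mult_delta_right)
    finally show ?thesis by (simp add: Qbar_def Diag_def diag_of_def q_def)
  qed
  have c: "c_vec H r = - (Q *v x) - h"
    by (simp add: c_vec_def r Q_def Q_mat_def h_def matrix_vector_right_distrib matrix_vector_mul_assoc)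
  have "superpose idx (assignment idx x) = x"
    by (simp add: vec_eq_iff superpose_def \<kappa> if_distrib[of "\<lambda>a. a *\<^sub>R b" for b] cong: if_cong)
  then have "(assignment idx x - t) \<bullet> (G_tilde idx H *v t + w_vec idx H r)
      = (x - z) \<bullet> ((Q - Diag (diag_of Q)) *v z + c_vec H r)"
    by (subst inner_superpose[where y = "(Q - Diag (diag_of Q)) *v z + c_vec H r" and idx = idx])
       (simp_all add: superpose_diff z_def G_tilde_mult w_vec_nth inner_add_left Q_def)
  also have "\<dots> = - (d \<bullet> (Q *v d - Diag (diag_of Q) *v z - h))"
    by (simp add: c d_def matrix_vector_mult_diff_rdistrib matrix_vector_mult_diff_distrib inner_diff_left
        inner_diff_right inner_add_right)
  finally have "d \<bullet> (Q *v d) - d \<bullet> (Diag (diag_of Q) *v z) - d \<bullet> h \<le> 0"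
    using vi by (simp add: inner_diff_right)
  then have "d \<bullet> (Qbar *v d) + (\<Sum>j\<in>UNIV. q j * (1/2 * (d $ j \<bullet> d $ j) - d $ j \<bullet> z $ j)) - d \<bullet> h \<le> 0"
    by (simp add: Qb D sum_subtractf right_diff_distrib sum_distrib_left mult.left_commute)
  \<comment> \<open>Since \<open>x $ j\<close> has modulus 1, the cross terms cancel. What remains
    is nonnegative on the unit disc, so its coefficient \<open>q j\<close> may be lowered to
    \<open>2 * \<mu>\<close>.\<close>
  moreover have "1/2 * (d $ j \<bullet> d $ j) - d $ j \<bullet> z $ j = 1/2 * (1 - z $ j \<bullet> z $ j)" for j
    by (simp add: d_def \<kappa> inner_diff_left inner_diff_right inner_commute[of "symbol idx _" "z $ _"] field_simps)
  ultimately have "d \<bullet> (Qbar *v d) + (\<Sum>j\<in>UNIV. q j * (1/2 * (1 - z $ j \<bullet> z $ j))) - d \<bullet> h \<le> 0"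
    by (simp only:)
  moreover have "\<mu> * (\<Sum>j\<in>UNIV. d $ j \<bullet> d $ j) \<le> d \<bullet> (Qbar *v d)"
    using ray[of d] by (simp add: inner_vec_def)
  moreover have "(\<Sum>j\<in>UNIV. \<mu> * (1 - z $ j \<bullet> z $ j)) \<le> (\<Sum>j\<in>UNIV. q j * (1/2 * (1 - z $ j \<bullet> z $ j)))"
  proof (rule sum_mono)
    fix j
    have "z $ j \<bullet> z $ j \<le> 1" using z1[of j] by (simp add: dot_square_norm power_le_one)
    then show "\<mu> * (1 - z $ j \<bullet> z $ j) \<le> q j * (1/2 * (1 - z $ j \<bullet> z $ j))"
      using mult_right_mono[OF q[of j], of "1/2 * (1 - z $ j \<bullet> z $ j)"] by simp
  qed
  moreover have "d \<bullet> h \<le> (\<Sum>j\<in>UNIV. N * norm (d $ j))"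
    unfolding inner_vec_def
  proof (rule sum_mono)
    fix j
    have "d $ j \<bullet> h $ j \<le> norm (d $ j) * norm (h $ j)" by (rule norm_cauchy_schwarz)
    also have "\<dots> \<le> norm (d $ j) * N" by (intro mult_left_mono) (auto simp: N_def norm_le_linf_norm)
    finally show "d $ j \<bullet> h $ j \<le> N * norm (d $ j)" by (simp add: mult.commute)
  qed
  ultimately have "\<mu> * (\<Sum>j\<in>UNIV. d $ j \<bullet> d $ j) + (\<Sum>j\<in>UNIV. \<mu> * (1 - z $ j \<bullet> z $ j))
      - (\<Sum>j\<in>UNIV. N * norm (d $ j)) \<le> 0"
    by linarith
  \<comment> \<open>With the same factor \<open>\<mu>\<close> on both terms the squares of
    \<open>z $ j\<close> cancel, leaving exactly the affine quantity that
    \<open>polygon_cone\<close> bounds from below.\<close>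
  moreover have "\<mu> * (d $ j \<bullet> d $ j) + \<mu> * (1 - z $ j \<bullet> z $ j) = 2 * \<mu> * (1 - x $ j \<bullet> z $ j)" for j
    by (simp add: d_def \<kappa> inner_diff_left inner_diff_right inner_commute[of "symbol idx _" "z $ _"] algebra_simps)
  ultimately have le: "(\<Sum>j\<in>UNIV. 2 * \<mu> * (1 - x $ j \<bullet> z $ j) - N * norm (d $ j)) \<le> 0"
    by (simp add: sum_distrib_left sum_subtractf flip: sum.distrib)
  have "(2 * \<mu> * s - N) * norm (d $ j) \<le> 2 * \<mu> * (1 - x $ j \<bullet> z $ j) - N * norm (d $ j)" for j
  proof -
    have nd: "norm (d $ j) = norm (x $ j - z $ j)" by (simp add: d_def norm_minus_commute)
    have "s * norm (d $ j) \<le> 1 - x $ j \<bullet> z $ j"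
      using polygon_cone[OF bij t0 t1[of j], of "\<kappa> j"]
      unfolding nd s_def \<kappa>(1) zj .
    then have "2 * \<mu> * (s * norm (d $ j)) \<le> 2 * \<mu> * (1 - x $ j \<bullet> z $ j)"
      using \<mu> by (intro mult_left_mono) auto
    then show ?thesis by (simp add: left_diff_distrib mult.assoc)
  qed
  then have "(\<Sum>j\<in>UNIV. (2 * \<mu> * s - N) * norm (d $ j)) \<le> 0"
    by (rule order_trans[OF sum_mono le])
  then have "(\<Sum>j\<in>UNIV. norm (d $ j)) \<le> 0"
    using N by (simp add: mult_le_0_iff flip: sum_distrib_left)
  then have "(\<Sum>j\<in>UNIV. norm (d $ j)) = 0"
    by (intro antisym sum_nonneg) auto
  then have "d $ j = 0" for j by (simp add: sum_nonneg_eq_0_iff)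
  then have "z $ j = symbol idx (\<kappa> j)" for j by (simp add: d_def \<kappa>)
  \<comment> \<open>Equal superpositions determine \<open>t\<close> here because every
    \<open>x $ j\<close> is a vertex of the polygon.\<close>
  then have "t $ (j, k) = assignment idx x $ (j, k)" for j k
    using polygon_vertex[OF M bij, of "\<lambda>k. t $ (j, k)" "\<kappa> j" k] t0 t1 \<kappa>(2) by (simp add: zj)
  then show ?thesis by (simp add: vec_eq_iff)
qed

section \<open>Minimizers and gradients\<close>

text \<open>Were infinitely many terms at distance at least \<open>e\<close> from \<open>l\<close>,
  compactness would give them a convergent subsequence, whose limit keeps that distance.\<close>

lemma compact_tendsto_if_subseq:
  fixes X :: "nat \<Rightarrow> 'a::metric_space"
  assumes S: "compact S" "\<And>n. X n \<in> S"
    and sub: "\<And>f a. strict_mono f \<Longrightarrow> (X \<circ> f) \<longlonglongrightarrow> a \<Longrightarrow> a = l"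
  shows "X \<longlonglongrightarrow> l"
proof (rule ccontr)
  assume "\<not> X \<longlonglongrightarrow> l"
  then obtain e where e: "e > 0" "\<not> (\<forall>\<^sub>F n in sequentially. dist (X n) l < e)"
    unfolding tendsto_iff by blast
  then have "\<exists>\<^sub>F n in sequentially. dist (X n) l \<ge> e"
    by (simp add: not_eventually not_less)
  then have "infinite {n. dist (X n) l \<ge> e}"
    by (simp add: frequently_cofinite flip: cofinite_eq_sequentially)
  then obtain f :: "nat \<Rightarrow> nat" where f: "strict_mono f" "\<And>n. dist (X (f n)) l \<ge> e"
    using infinite_enumerate by blast
  from S obtain a g where g: "strict_mono g" "((X \<circ> f) \<circ> g) \<longlonglongrightarrow> a"
    unfolding compact_def by (metis comp_apply)
  have "a = l"
    using g f(1) by (intro sub[of "f \<circ> g"]) (simp_all add: strict_mono_o comp_assoc)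
  moreover have "dist a l \<ge> e"
    using g(2) f(2) by (intro LIMSEQ_le_const[OF tendsto_dist[OF g(2) tendsto_const]]) auto
  ultimately show False using e(1) by simp
qed

text \<open>The exact Taylor expansion; symmetry of \<open>G_tilde idx H\<close> merges the two
  cross terms.\<close>

lemma objective_expand:
  "objective idx H r (t + h) = objective idx H r t
     + 2 * (h \<bullet> (G_tilde idx H *v t + w_vec idx H r)) + h \<bullet> (G_tilde idx H *v h)"
  by (simp add: objective_def matrix_vector_right_distrib inner_add_left inner_add_right
      G_tilde_symmetric[of t idx H h] inner_commute[of "w_vec idx H r" h])

text \<open>The segment from \<open>s\<close> to \<open>t\<close> stays feasible by convexity; the
  increase of the objective along it is divided by the step \<open>e\<close>, which then tends to
  0.\<close>

lemma rsqp_minimizer_stationary: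
  assumes s: "is_arg_min (objective idx H r) rsqp_feasible s" and t: "rsqp_feasible t"
  shows "0 \<le> (t - s) \<bullet> (G_tilde idx H *v s + w_vec idx H r)"
proof -
  define g where "g = (t - s) \<bullet> (G_tilde idx H *v s + w_vec idx H r)"
  define q where "q = (t - s) \<bullet> (G_tilde idx H *v (t - s))"
  have "0 \<le> 2 * g + e * q" if e: "0 < e" "e \<le> 1" for e
  proof -
    have "rsqp_feasible s" using s by (simp add: is_arg_min_def)
    then have "rsqp_feasible (s + e *\<^sub>R (t - s))"
    proof -
      have "s $ p + e * (t $ p - s $ p) = (1 - e) * s $ p + e * t $ p" for p
        by (simp add: algebra_simps)
      then show ?thesis
        using \<open>rsqp_feasible s\<close> t e
        by (simp add: rsqp_feasible_def one_inner_vec_block sum.distrib flip: sum_distrib_left)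
    qed
    then have "objective idx H r s \<le> objective idx H r (s + e *\<^sub>R (t - s))"
      using s by (auto simp: is_arg_min_def not_less)
    also have "\<dots> = objective idx H r s + 2 * (e * g) + e * (e * q)"
      by (simp only: objective_expand matrix_vector_mult_scaleR inner_scaleR_left inner_scaleR_right
          g_def q_def)
    finally have "0 \<le> e * (2 * g + e * q)"
      by (simp add: algebra_simps)
    then show ?thesis using e by (simp add: zero_le_mult_iff)
  qed
  then have "0 \<le> 2 * g + inverse (real (Suc n)) * q" for n
    by (simp add: inverse_le_1_iff)
  moreover have "(\<lambda>n. 2 * g + inverse (real (Suc n)) * q) \<longlonglongrightarrow> 2 * g + 0 * q"
    by (intro tendsto_intros LIMSEQ_inverse_real_of_nat)
  ultimately have "0 \<le> 2 * g + 0 * q"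
    by (intro LIMSEQ_le_const) auto
  then show ?thesis by (simp add: g_def)
qed

section \<open>Compactness and existence of minimizers\<close>

lemma box_set_eq_cbox: "box_set K = cbox 0 (\<chi> i. K)"
  by (auto simp: box_set_def mem_box_cart)

lemma rsqp_feasible_subset_box:
  "{t :: real ^ ('n::finite \<times> 'M::finite). rsqp_feasible t} \<subseteq> box_set 1"
proof
  fix t :: "real ^ ('n \<times> 'M)" assume "t \<in> {t. rsqp_feasible t}"
  then have t: "\<And>p. t $ p \<ge> 0" "\<And>j. (\<Sum>k\<in>UNIV. t $ (j, k)) = 1"
    unfolding rsqp_feasible_def one_inner_vec_block by auto
  have "t $ (j, k) \<le> 1" for j k
    using member_le_sum[of k UNIV "\<lambda>k. t $ (j, k)"] t by simp
  with t show "t \<in> box_set 1" by (auto simp: box_set_def)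
qed

lemma rsqp_minimizer_exists:
  assumes "rsqp_feasible (a :: real ^ ('n::finite \<times> 'M::finite))"
  obtains s where "is_arg_min (objective idx H r) rsqp_feasible (s :: real ^ ('n \<times> 'M))"
proof -
  let ?F = "{t :: real ^ ('n \<times> 'M). rsqp_feasible t}"
  have "bounded ?F" using rsqp_feasible_subset_box unfolding box_set_eq_cbox using bounded_cbox bounded_subset by blast
  moreover have "?F = (\<Inter>j. {t. (\<Sum>k\<in>UNIV. t $ (j, k)) = 1}) \<inter> (\<Inter>p. {t. 0 \<le> t $ p})"
    by (auto simp: rsqp_feasible_def one_inner_vec_block)
  then have "closed ?F"
    by (simp only:) (intro closed_Int closed_INT ballI closed_Collect_eq closed_Collect_le continuous_intros)
  moreover have "continuous_on ?F (objective idx H r)"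
    unfolding objective_def
    by (intro continuous_intros linear_continuous_on matrix_vector_mul_bounded_linear)
  ultimately obtain s where "s \<in> ?F" "\<And>t. t \<in> ?F \<Longrightarrow> objective idx H r s \<le> objective idx H r t"
    using continuous_attains_inf[of ?F] assms by (auto simp: compact_eq_bounded_closed)
  then have "is_arg_min (objective idx H r) rsqp_feasible s"
    by (auto simp: is_arg_min_def not_less)
  then show thesis by (rule that)
qed

section \<open>The gradient of the penalty objective\<close>

lemma gradient_eqI:
  assumes "GDERIV f x :> D"
  shows "gradient f x = D"
  unfolding gradient_def
proof (rule the_equality)
  fix E assume "GDERIV f x :> E"
  then have "(\<lambda>h. h \<bullet> E) = (\<lambda>h. h \<bullet> D)"
    using assms unfolding gderiv_def by (rule has_derivative_unique)
  then show "E = D" by (metis inner_commute vector_eq_ldot)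
qed fact

text \<open>The penalty part of the gradient is constant on blocks, so it is orthogonal to
  differences of points with equal block sums.\<close>

lemma inner_block_const:
  "s \<bullet> (\<chi> p. g (fst p)) = (\<Sum>j\<in>UNIV. g j * (\<Sum>k\<in>UNIV. s $ (j, k)))"
  by (simp add: inner_vec_def sum_UNIV_prod sum_distrib_left mult.commute)

lemma gradient_penalty_objective:
  "gradient (penalty_objective idx H r om) t =
     2 *\<^sub>R (G_tilde idx H *v t + w_vec idx H r) + om *\<^sub>R (\<chi> p. (\<Sum>k\<in>UNIV. t $ (fst p, k)) - 1)"
proof (rule gradient_eqI)
  let ?G = "G_tilde idx H" and ?w = "w_vec idx H r"
  have 1: "((\<lambda>t. ?G *v t) has_derivative (*v) ?G) (at t)"
    by (intro bounded_linear_imp_has_derivative matrix_vector_mul_bounded_linear)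
  have 2: "((\<lambda>t. t $ (j, k)) has_derivative (\<lambda>h. h $ (j, k))) (at t)" for j k
    by (intro bounded_linear_imp_has_derivative bounded_linear_vec_nth)
  have "(penalty_objective idx H r om has_derivative
      (\<lambda>h. t \<bullet> (?G *v h) + h \<bullet> (?G *v t) + 2 * (?w \<bullet> h) +
        om / 2 * (\<Sum>j\<in>UNIV. 2 * (\<Sum>k\<in>UNIV. h $ (j, k)) * ((\<Sum>k\<in>UNIV. t $ (j, k)) - 1)))) (at t)"
    unfolding penalty_objective_def objective_def one_inner_vec_block
    by (rule derivative_eq_intros 1 2 refl | simp)+
  then show "GDERIV (penalty_objective idx H r om) t :>
      2 *\<^sub>R (?G *v t + ?w) + om *\<^sub>R (\<chi> p. (\<Sum>k\<in>UNIV. t $ (fst p, k)) - 1)"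
    unfolding gderiv_def
    by (rule has_derivative_subst)
       (simp add: fun_eq_iff inner_add_right inner_block_const[where g = "\<lambda>j. (\<Sum>k\<in>UNIV. t $ (j, k)) - 1"]
         G_tilde_symmetric[of t] inner_commute[of ?w] sum_distrib_left sum_distrib_right ac_simps)
qed

section \<open>Limit points of the penalty method\<close>

definition block_sum :: "real ^ ('n::finite \<times> 'M::finite) \<Rightarrow> 'n \<Rightarrow> real" where
  "block_sum t j = (\<Sum>k\<in>UNIV. t $ (j, k))"

text \<open>
  Comparing an iterate with a point of the box that has the same block sums makes the penalty term
  drop out of the projection inequality. Here the block sums of \<open>y\<close> are imposed on \<open>a\<close>, by scaling
  a block down, or by moving it towards the corner \<open>(K, \<dots>, K)\<close>, so that the result tends to \<open>a\<close>
  as the block sums of \<open>y\<close> tend to \<open>1\<close>.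
\<close>
definition redistribute ::
  "real \<Rightarrow> real ^ ('n::finite \<times> 'M::finite) \<Rightarrow> real ^ ('n \<times> 'M) \<Rightarrow> real ^ ('n \<times> 'M)" where
  "redistribute K a y = (\<chi> p. min (block_sum y (fst p)) 1 * a $ p +
     max (block_sum y (fst p) - 1) 0 / (real CARD('M) * K - 1) * (K - a $ p))"

text \<open>The corner has block sum MK and \<open>a\<close> has 1, so moving the fraction
  \<open>\<nu> j\<close> towards the corner adds \<open>\<nu> j * (M K - 1)\<close>. This fraction
  is at most 1 because block sums in the box never exceed MK.\<close>

lemma redistribute:
  fixes a y :: "real ^ ('n::finite \<times> 'M::finite)"
  assumes K: "K \<ge> 1" and M: "CARD('M) \<ge> 2" and y: "y \<in> box_set K"
    and a: "a \<in> box_set 1" "\<And>j. block_sum a j = 1"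
  shows "redistribute K a y \<in> box_set K" "block_sum (redistribute K a y) j = block_sum y j"
proof -
  have "2 * 1 \<le> real CARD('M) * K" using K M by (intro mult_mono) auto
  then have MK: "real CARD('M) * K - 1 > 0" by simp
  define \<kappa> where "\<kappa> = block_sum y"
  define \<nu> where "\<nu> j = max (\<kappa> j - 1) 0 / (real CARD('M) * K - 1)" for j
  have y': "0 \<le> y $ p" "y $ p \<le> K" for p using y unfolding box_set_def by blast+
  have a': "0 \<le> a $ p" "a $ p \<le> 1" "a $ p \<le> K" for p
    using a(1) K unfolding box_set_def by (blast intro: order_trans)+
  have \<kappa>0: "\<kappa> j \<ge> 0" for j unfolding \<kappa>_def block_sum_def by (intro sum_nonneg y')
  have "\<kappa> j \<le> real CARD('M) * K" for j
    unfolding \<kappa>_def block_sum_def using sum_bounded_above[of UNIV "\<lambda>k. y $ (j, k)" K] y' by simp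
  then have \<nu>: "0 \<le> \<nu> j" "\<nu> j \<le> 1" for j
    using MK by (auto simp: \<nu>_def)
  have eq: "redistribute K a y $ p = min (\<kappa> (fst p)) 1 * a $ p + \<nu> (fst p) * (K - a $ p)" for p
    by (simp add: redistribute_def \<kappa>_def \<nu>_def)
  show "redistribute K a y \<in> box_set K"
    unfolding box_set_def eq mem_Collect_eq
  proof (intro allI conjI)
    fix p
    have "\<nu> (fst p) * (K - a $ p) \<ge> 0" using \<nu> a' by simp
    moreover have "min (\<kappa> (fst p)) 1 * a $ p \<ge> 0"
      using \<kappa>0[of "fst p"] a'(1)[of p] by (intro mult_nonneg_nonneg) auto
    ultimately show "0 \<le> min (\<kappa> (fst p)) 1 * a $ p + \<nu> (fst p) * (K - a $ p)"
      by linarith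
    have "min (\<kappa> (fst p)) 1 * a $ p \<le> a $ p"
      using a' by (intro mult_left_le_one_le) (auto simp: \<kappa>0)
    moreover have "\<nu> (fst p) * (K - a $ p) \<le> K - a $ p"
      using a' \<nu> by (intro mult_left_le_one_le) auto
    ultimately show "min (\<kappa> (fst p)) 1 * a $ p + \<nu> (fst p) * (K - a $ p) \<le> K"
      by linarith
  qed
  have "block_sum (redistribute K a y) j
      = min (\<kappa> j) 1 * block_sum a j + \<nu> j * (real CARD('M) * K - block_sum a j)"
    unfolding block_sum_def eq by (simp add: sum.distrib sum_subtractf flip: sum_distrib_left)
  also have "\<dots> = min (\<kappa> j) 1 + max (\<kappa> j - 1) 0"
    using MK by (simp add: a \<nu>_def)
  finally show "block_sum (redistribute K a y) j = block_sum y j"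
    by (simp add: \<kappa>_def min_def max_def)
qed

text \<open>\<open>T\<close> are iterates along a subsequence, \<open>Y\<close> their projected
  gradient steps, and \<open>vi\<close> is the obtuse-angle property of the projection. It is used
  twice: at \<open>a\<close>, divided by \<open>om n\<close>, for feasibility of \<open>b\<close>,
  and at the redistributed points for stationarity.\<close>

lemma penalty_limit:
  fixes T Y :: "nat \<Rightarrow> real ^ ('n::finite \<times> 'M::finite)"
  assumes K: "K \<ge> 1" and M: "CARD('M) \<ge> 2"
    and a: "a \<in> box_set 1" "\<And>j. block_sum a j = 1"
    and Y: "\<And>n. Y n \<in> box_set K"
    and lim: "T \<longlonglongrightarrow> b" "Y \<longlonglongrightarrow> b" "(\<lambda>n. g (T n)) \<longlonglongrightarrow> g b"
    and om: "filterlim om at_top sequentially"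
    and vi: "\<And>n s. s \<in> box_set K \<Longrightarrow>
      (T n - (g (T n) + om n *\<^sub>R (\<chi> p. block_sum (T n) (fst p) - 1)) - Y n) \<bullet> (s - Y n) \<le> 0"
  shows "block_sum b j = 1" "0 \<le> (a - b) \<bullet> g b"
proof -
  have pen: "s \<bullet> (\<chi> p. block_sum t (fst p) - 1) = (\<Sum>j\<in>UNIV. (block_sum t j - 1) * block_sum s j)"
    for s t :: "real ^ ('n \<times> 'M)"
    by (subst inner_block_const[where g = "\<lambda>j. block_sum t j - 1"]) (simp add: block_sum_def)
  have bs_diff: "block_sum (s - t) j = block_sum s j - block_sum t j"
    for s t :: "real ^ ('n \<times> 'M)" and j by (simp add: block_sum_def sum_subtractf)
  have vi': "(T n - Y n) \<bullet> (s - Y n) \<le> (s - Y n) \<bullet> g (T n) +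
      om n * (\<Sum>j\<in>UNIV. (block_sum (T n) j - 1) * (block_sum s j - block_sum (Y n) j))"
    if "s \<in> box_set K" for n s
    using vi[OF that, of n]
    by (simp add: inner_diff_left inner_add_left inner_commute[of "g _"]
        inner_commute[of "\<chi> p. block_sum _ (fst p) - 1"] pen bs_diff[symmetric])
  have bs_lim: "(\<lambda>n. block_sum (X n) j) \<longlonglongrightarrow> block_sum x j" if "X \<longlonglongrightarrow> x"
    for X :: "nat \<Rightarrow> real ^ ('n \<times> 'M)" and x j
    unfolding block_sum_def by (intro tendsto_intros that)
  have aK: "a \<in> box_set K" using a(1) K by (auto simp: box_set_def intro: order_trans)
  \<comment> \<open>Dividing the projection inequality at \<open>a\<close> by the penalty parameter leaves only the infeasibility.\<close>
  have "\<forall>\<^sub>F n in sequentially. (T n - Y n) \<bullet> (a - Y n) / om n \<le> (a - Y n) \<bullet> g (T n) / om n +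
      (\<Sum>j\<in>UNIV. (block_sum (T n) j - 1) * (block_sum a j - block_sum (Y n) j))"
    using filterlim_at_top_dense[THEN iffD1, OF om, rule_format, of 0]
  proof eventually_elim
    case (elim n)
    then show ?case using vi'[OF aK, of n] by (simp add: field_simps)
  qed
  moreover have "(\<lambda>n. (T n - Y n) \<bullet> (a - Y n) / om n) \<longlonglongrightarrow> 0"
    by (rule tendsto_divide_0[OF tendsto_inner[OF tendsto_diff[OF lim(1,2)] tendsto_diff[OF tendsto_const lim(2)]]])
       (rule filterlim_at_top_imp_at_infinity[OF om])
  moreover have "(\<lambda>n. (a - Y n) \<bullet> g (T n) / om n +
      (\<Sum>j\<in>UNIV. (block_sum (T n) j - 1) * (block_sum a j - block_sum (Y n) j)))
     \<longlonglongrightarrow> 0 + (\<Sum>j\<in>UNIV. (block_sum b j - 1) * (block_sum a j - block_sum b j))"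
    by (intro tendsto_add tendsto_sum tendsto_mult tendsto_diff tendsto_const bs_lim lim
        tendsto_divide_0[OF tendsto_inner[OF tendsto_diff[OF tendsto_const lim(2)] lim(3)]]
        filterlim_at_top_imp_at_infinity[OF om])
  ultimately have "0 \<le> 0 + (\<Sum>j\<in>UNIV. (block_sum b j - 1) * (block_sum a j - block_sum b j))"
    by (intro tendsto_le[OF sequentially_bot])
  then have "0 \<le> (\<Sum>j\<in>UNIV. - (block_sum b j - 1)\<^sup>2)"
    by (simp add: a power2_eq_square algebra_simps)
  then have "(\<Sum>j\<in>UNIV. (block_sum b j - 1)\<^sup>2) = 0"
    by (intro antisym sum_nonneg) (auto simp: sum_negf)
  then have b: "block_sum b j = 1" for j
    by (simp add: sum_nonneg_eq_0_iff)
  then show "block_sum b j = 1" .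
  have "2 * 1 \<le> real CARD('M) * K" using K M by (intro mult_mono) auto
  then have MK: "real CARD('M) * K - 1 \<noteq> 0" by simp
  define S where "S n = redistribute K a (Y n)" for n
  have "S \<longlonglongrightarrow> (\<chi> p. min 1 1 * a $ p + max (1 - 1) 0 / (real CARD('M) * K - 1) * (K - a $ p))"
    unfolding S_def redistribute_def
    by (intro tendsto_vec_lambda tendsto_add tendsto_mult tendsto_min tendsto_max tendsto_const
        tendsto_diff tendsto_divide MK bs_lim[OF lim(2), unfolded b])
  then have S: "S \<longlonglongrightarrow> a" by simp
  \<comment> \<open>The block sums of \<open>S n\<close> and \<open>Y n\<close> agree, so the
    unbounded factor \<open>om n\<close> multiplies zero and no rate for the infeasibility is
    required.\<close>
  have "(T n - Y n) \<bullet> (S n - Y n) \<le> (S n - Y n) \<bullet> g (T n)" for n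
    using vi'[of "S n" n] redistribute[OF K M Y a] by (simp add: S_def)
  moreover have "(\<lambda>n. (T n - Y n) \<bullet> (S n - Y n)) \<longlonglongrightarrow> (b - b) \<bullet> (a - b)"
    by (intro tendsto_intros lim S)
  moreover have "(\<lambda>n. (S n - Y n) \<bullet> g (T n)) \<longlonglongrightarrow> (a - b) \<bullet> g b"
    by (intro tendsto_intros lim S)
  ultimately have "(b - b) \<bullet> (a - b) \<le> (a - b) \<bullet> g b"
    by (intro LIMSEQ_le) auto
  then show "0 \<le> (a - b) \<bullet> g b" by simp
qed

text \<open>Every limit point is feasible and stationary towards \<open>a\<close>, hence equal to
  \<open>a\<close>; compactness of the box then gives convergence of the whole sequence.\<close>

lemma pnqp_sequence_converges:
  fixes H :: "complex ^ 'n::finite ^ 'm::finite" and idx :: "'M::finite \<Rightarrow> nat"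
  assumes M: "CARD('M) \<ge> 2"
    and a: "rsqp_feasible a"
    and unique: "\<And>b. rsqp_feasible b \<Longrightarrow> 0 \<le> (a - b) \<bullet> (G_tilde idx H *v b + w_vec idx H r) \<Longrightarrow> b = a"
    and seq: "pnqp_sequence idx H r K \<rho> om \<tau> t"
  shows "t \<longlonglongrightarrow> a"
proof -
  \<comment> \<open>The shift discards \<open>t 0\<close>, about which the method says nothing and
    which need not lie in the box.\<close>
  define T where "T n = t (Suc n)" for n
  define om' where "om' n = om (Suc n)" for n
  define g where "g s = 2 *\<^sub>R (G_tilde idx H *v s + w_vec idx H r)" for s
  define Y where "Y n = closest_point (box_set K)
      (T n - (g (T n) + om' n *\<^sub>R (\<chi> p. block_sum (T n) (fst p) - 1)))" for n
  have K: "K \<ge> 1" and \<rho>: "\<rho> > 1" and om: "om 1 > 0" "\<And>k. k \<ge> 1 \<Longrightarrow> om (Suc k) = \<rho> * om k"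
    and \<tau>: "\<tau> \<longlonglongrightarrow> 0" and t: "\<And>k. k \<ge> 1 \<Longrightarrow> t k \<in> box_set K"
    "\<And>k. k \<ge> 1 \<Longrightarrow> norm (t k - closest_point (box_set K)
                (t k - gradient (penalty_objective idx H r (om k)) (t k))) \<le> \<tau> k"
    using seq by (auto simp: pnqp_sequence_def)
  have TB: "T n \<in> box_set K" for n using t by (simp add: T_def)
  have TY: "norm (T n - Y n) \<le> \<tau> (Suc n)" for n
    using t(2)[of "Suc n"]
    by (simp add: T_def Y_def om'_def g_def gradient_penalty_objective block_sum_def)
  have om_pow: "om' n = \<rho> ^ n * om 1" for n
    by (induction n) (simp_all add: om'_def om)
  have om_top: "filterlim om' at_top sequentially"
  proof -
    have "filterlim (\<lambda>n. \<rho> ^ n) at_top sequentially"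
      using \<rho> by (intro filterlim_at_infinity_imp_filterlim_at_top filterlim_realpow_sequentially_gt1) auto
    from filterlim_tendsto_pos_mult_at_top[OF tendsto_const om(1) this] show ?thesis
      by (simp add: om_pow[abs_def] mult.commute)
  qed
  have box: "closed (box_set K :: (real ^ ('n \<times> 'M)) set)" "convex (box_set K :: (real ^ ('n \<times> 'M)) set)"
     "compact (box_set K :: (real ^ ('n \<times> 'M)) set)"
    by (simp_all add: box_set_eq_cbox closed_cbox compact_cbox)
  have YB: "Y n \<in> box_set K" for n
    unfolding Y_def using TB by (intro closest_point_in_set box) auto
  have a1: "a \<in> box_set 1" "\<And>j. block_sum a j = 1"
    using a rsqp_feasible_subset_box by (auto simp: rsqp_feasible_def one_inner_vec_block block_sum_def)
  have "T \<longlonglongrightarrow> a"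
  proof (rule compact_tendsto_if_subseq[OF box(3) TB])
    fix f b assume f: "strict_mono (f :: nat \<Rightarrow> nat)" and lim: "(T \<circ> f) \<longlonglongrightarrow> b"
    have "(\<lambda>n. \<tau> (Suc n)) \<longlonglongrightarrow> 0" using \<tau> by (rule LIMSEQ_Suc)
    \<comment> \<open>Vanishing tolerances make iterates and projected points share their
      limits.\<close>
    then have "(\<lambda>n. T n - Y n) \<longlonglongrightarrow> 0"
      by (rule Lim_null_comparison[rotated]) (simp add: TY)
    then have "(\<lambda>n. (T \<circ> f) n - (T (f n) - Y (f n))) \<longlonglongrightarrow> b - 0"
      using LIMSEQ_subseq_LIMSEQ[OF _ f] by (intro tendsto_diff lim) (simp add: comp_def)
    then have limY: "(Y \<circ> f) \<longlonglongrightarrow> b" by (simp add: comp_def)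
    have limg: "(\<lambda>n. g ((T \<circ> f) n)) \<longlonglongrightarrow> g b"
      unfolding g_def
      by (intro tendsto_intros bounded_linear.tendsto[OF matrix_vector_mul_bounded_linear] lim)
    have limom: "filterlim (om' \<circ> f) at_top sequentially"
      unfolding comp_def by (rule filterlim_compose[OF om_top filterlim_subseq[OF f]])
    have vi: "((T \<circ> f) n - (g ((T \<circ> f) n) + (om' \<circ> f) n *\<^sub>R (\<chi> p. block_sum ((T \<circ> f) n) (fst p) - 1))
        - (Y \<circ> f) n) \<bullet> (s - (Y \<circ> f) n) \<le> 0" if "s \<in> box_set K" for n s
      using that unfolding Y_def comp_def by (intro closest_point_dot box)
    have YBf: "(Y \<circ> f) n \<in> box_set K" for n by (simp add: YB)
    note pl = penalty_limit[OF K M a1 YBf lim limY limg limom vi]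
    have "b \<in> box_set K"
      using closed_sequentially[OF box(1) _ lim] TB by simp
    then have "rsqp_feasible b"
      using pl(1) by (simp add: rsqp_feasible_def one_inner_vec_block box_set_def flip: block_sum_def)
    moreover have "0 \<le> (a - b) \<bullet> (G_tilde idx H *v b + w_vec idx H r)"
      using pl(2) by (simp add: g_def)
    ultimately show "b = a" by (rule unique)
  qed
  then show ?thesis unfolding T_def by (rule LIMSEQ_imp_Suc)
qed

theorem theorem4p9:
  fixes H :: "complex ^ 'n::finite ^ 'm::finite"
    and xstar :: "complex ^ 'n"
    and v r :: "complex ^ 'm"
    and idx :: "'M::finite \<Rightarrow> nat"
    and tstar :: "real ^ ('n \<times> 'M)"
    and Qbar :: "complex ^ 'n ^ 'n"
  assumes "CARD('M) \<ge> 2"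
    and "bij_betw idx UNIV {1..CARD('M)}"
    and "\<forall>j. xstar $ j \<in> constellation CARD('M)"
    and "r = H *v xstar + v"
    and "tstar = assignment idx xstar"
    and "Qbar = conj_transpose H ** H
                  - (1/2) *\<^sub>R Diag (diag_of (conj_transpose H ** H))"
    and "lambda_min (conj_transpose H ** H) * sin (pi / real CARD('M))
           > linf_norm (conj_transpose H *v v)"
    and "sqrt 2 * lambda_min Qbar * sin (pi / real CARD('M))
           > linf_norm (conj_transpose H *v v)"
  shows "(\<forall>K \<rho> om \<tau> t. pnqp_sequence idx H r K \<rho> om \<tau> t \<longrightarrow> t \<longlonglongrightarrow> tstar) \<and>
         (\<forall>s. is_arg_min (objective idx H r) rsqp_feasible s \<longleftrightarrow> s = tstar)"
proof -
  have x: "\<And>j. xstar $ j \<in> constellation CARD('M)" using assms(3) by blast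
  have unique: "b = tstar"
    if "rsqp_feasible b" "0 \<le> (tstar - b) \<bullet> (G_tilde idx H *v b + w_vec idx H r)" for b
    using stationary_unique[OF assms(1,2) x assms(4) _ that(1)] that(2) assms(8)
    by (simp add: assms(5,6) Q_mat_def)
  obtain \<kappa> where "\<And>j k. tstar $ (j, k) = (if k = \<kappa> j then 1 else 0)"
    unfolding assms(5) using assignment_symbols[OF assms(1,2) x] by metis
  then have feas: "rsqp_feasible tstar"
    by (simp add: rsqp_feasible_def one_inner_vec_block)
  have min: "s = tstar" if "is_arg_min (objective idx H r) rsqp_feasible s" for s
    using that by (intro unique rsqp_minimizer_stationary feas) (simp_all add: is_arg_min_def)
  \<comment> \<open>Optimality of \<open>tstar\<close> is obtained indirectly: some minimizer
    exists, and stationarity forces it to be \<open>tstar\<close>.\<close>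
  obtain s where s: "is_arg_min (objective idx H r) rsqp_feasible s"
    using rsqp_minimizer_exists[OF feas] .
  have "is_arg_min (objective idx H r) rsqp_feasible tstar" using s min[OF s] by simp
  then show ?thesis
    using min pnqp_sequence_converges[OF assms(1) feas unique] by blast
qed

end
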